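(* Let $m\ge1$ be an integer. For all functions $f\in L_1[0,1]$ the following inequalities hold: $$\Big(1-\frac1e\Big)\|f\|'_m\ \le\ \|f\|^*_m\ \le\ \|f\|_{m,\infty}\ \le\ 2\,\|f\|'_m .$$
   Context: Here $[0,1]$ carries Lebesgue measure $\mu$, and $|\Delta|=\mu\Delta$ for measurable $\Delta\subset[0,1]$. For $f\in L_1[0,1]$: $$\|f\|_{m,\infty}:=\int_0^1\cdots\int_0^1\max\{|f(x_1)|,\dots,|f(x_m)|\}\,dx_1\cdots dx_m ,$$ $$\|f\|^*_m:=\sup_{\Delta}\Big\{\frac{1-(1-|\Delta|)^m}{|\Delta|}\int_\Delta|f|\,d\mu\Big\},$$ where the supremum is over measurable $\Delta\subset[0,1]$ with $|\Delta|>0$, and $$\|f\|'_m:=\sup_{\Delta\subset[0,1],\ \mu\Delta=1/m}\Big\{m\int_\Delta|f|\,d\mu\Big\},$$ where the supremum is over measurable $\Delta$ of measure exactly $1/m$. *)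

theory Defs
  imports "HOL-Analysis.Analysis"
begin

abbreviation unit_leb :: "real measure" where
  "unit_leb \<equiv> lebesgue_on {0..1}"

text \<open>
  The three functionals below are meant for \<open>f\<close> integrable on the unit interval and \<open>m \<ge> 1\<close>.
  Both suprema are then taken over nonempty sets of reals that are bounded above by
  \<open>m\<close> times the \<open>L\<^sub>1\<close>-norm of \<open>f\<close>, because \<open>1 - (1 - t) ^ m \<le> m * t\<close> for \<open>t\<close> in \<open>{0..1}\<close>;
  so the real-valued supremum is the actual one. Likewise the maximum in \<open>norm_m_inf\<close> is
  dominated by \<open>\<Sum>i=1..m. \<bar>f (x i)\<bar>\<close> and hence integrable for the product measure.
\<close>

definition norm_m_inf :: "nat \<Rightarrow> (real \<Rightarrow> real) \<Rightarrow> real" where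
  "norm_m_inf m f =
     (LINT x | (\<Pi>\<^sub>M i\<in>{1..m}. unit_leb). Max ((\<lambda>i. \<bar>f (x i)\<bar>) ` {1..m}))"

definition norm_star :: "nat \<Rightarrow> (real \<Rightarrow> real) \<Rightarrow> real" where
  "norm_star m f =
     (SUP \<Delta> \<in> {\<Delta> \<in> sets unit_leb. measure unit_leb \<Delta> > 0}.
        (1 - (1 - measure unit_leb \<Delta>) ^ m) / measure unit_leb \<Delta>
          * (LINT x:\<Delta>|unit_leb. \<bar>f x\<bar>))"

definition norm_prime :: "nat \<Rightarrow> (real \<Rightarrow> real) \<Rightarrow> real" where
  "norm_prime m f =
     (SUP \<Delta> \<in> {\<Delta> \<in> sets unit_leb. measure unit_leb \<Delta> = 1 / real m}.
        real m * (LINT x:\<Delta>|unit_leb. \<bar>f x\<bar>))"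

end

theory Submission
  imports Defs "HOL-Probability.Probability"
begin

text \<open>
  Write \<open>g = \<bar>f\<bar>\<close>. The first inequality is \<open>(1 - 1/m) ^ m \<le> 1/e\<close>. For the second, the maximum
  of \<open>g (x\<^sub>1), \<dots>, g (x\<^sub>m)\<close> dominates \<open>g (x\<^sub>i)\<close> for the first \<open>i\<close> with \<open>x\<^sub>i \<in> \<Delta>\<close>, whose expectation is
  the geometric sum \<open>(\<Sum>i. (1 - \<bar>\<Delta>\<bar>) ^ (i - 1)) \<integral>\<^sub>\<Delta> g\<close>. For the third, choose \<open>\<Delta>\<close> of measure \<open>1/m\<close> with
  \<open>{g > \<lambda>} \<subseteq> \<Delta> \<subseteq> {g \<ge> \<lambda>}\<close>; then the maximum is at most \<open>\<lambda> + (\<Sum>i. max 0 (g (x\<^sub>i) - \<lambda>))\<close>, whose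
  expectation is exactly \<open>m \<integral>\<^sub>\<Delta> g\<close>. So the last inequality even holds with constant \<open>1\<close>.
\<close>

section \<open>Pointwise bounds for a finite maximum\<close>

text \<open>The maximizing index already contributes its own excess over \<open>l\<close>, and the
  other terms are nonnegative. The level \<open>l\<close> stays free: 0 gives domination by the sum,
  a quantile gives the sharp bound.\<close>

lemma Max_le_add_sum_excess:
  fixes g :: "'a \<Rightarrow> real"
  assumes "finite I" "I \<noteq> {}"
  shows "Max (g ` I) \<le> l + (\<Sum>i\<in>I. max 0 (g i - l))"
proof -
  have "g i \<le> l + (\<Sum>i\<in>I. max 0 (g i - l))" if "i \<in> I" for i
  proof -
    have "max 0 (g i - l) \<le> (\<Sum>i\<in>I. max 0 (g i - l))"
      using assms that by (intro member_le_sum) auto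
    then show ?thesis by linarith
  qed
  then show ?thesis using assms by simp
qed

text \<open>For \<open>i\<close> in \<open>{1..m}\<close>, the product over \<open>j\<close> of
  these factors is \<open>g (x i)\<close> times the indicator that \<open>i\<close> is the first
  index with \<open>x i\<close> in \<open>D\<close>. One factor per coordinate lets the integral
  over the product space split.\<close>

definition first_hit :: "'a set \<Rightarrow> nat \<Rightarrow> nat \<Rightarrow> ('a \<Rightarrow> real) \<Rightarrow> 'a \<Rightarrow> real" where
  "first_hit D i j g y =
     (if j < i then 1 - indicator D y else if j = i then indicator D y * g y else 1)"

lemma sum_first_hit_le_Max:
  fixes g :: "'a \<Rightarrow> real"
  assumes nonneg: "\<And>y. g y \<ge> 0" and "m \<ge> 1"
  shows "(\<Sum>i=1..m. \<Prod>j=1..m. first_hit D i j g (x j)) \<le> Max ((\<lambda>i. g (x i)) ` {1..m})"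
proof (cases "\<exists>k\<in>{1..m}. x k \<in> D")
  case False
  have "(\<Prod>j=1..m. first_hit D i j g (x j)) = 0" if "i \<in> {1..m}" for i
    using that False by (intro prod_zero bexI[of _ i]) (auto simp: first_hit_def)
  then have "(\<Sum>i=1..m. \<Prod>j=1..m. first_hit D i j g (x j)) = 0"
    by (intro sum.neutral) blast
  also have "0 \<le> g (x 1)" by (rule nonneg)
  also have "\<dots> \<le> Max ((\<lambda>i. g (x i)) ` {1..m})" using \<open>m \<ge> 1\<close> by (intro Max_ge) auto
  finally show ?thesis .
next
  case True
  define k where "k = (LEAST k. k \<in> {1..m} \<and> x k \<in> D)"
  have k: "k \<in> {1..m}" "x k \<in> D"
    using LeastI_ex[of "\<lambda>k. k \<in> {1..m} \<and> x k \<in> D"] True unfolding k_def by blast+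
  have less_k: "x j \<notin> D" if "j < k" "j \<in> {1..m}" for j
    using not_less_Least that unfolding k_def by blast
  \<comment> \<open>For \<open>i < k\<close> the factor at \<open>i\<close> vanishes, since
    \<open>x i\<close> misses \<open>D\<close>; for \<open>i > k\<close> the factor at
    \<open>k\<close> vanishes, since \<open>x k\<close> hits \<open>D\<close>.\<close>
  have zero: "(\<Prod>j=1..m. first_hit D i j g (x j)) = 0" if "i \<in> {1..m} - {k}" for i
  proof (cases "i < k")
    case True
    then show ?thesis using that less_k[OF True]
      by (intro prod_zero bexI[of _ i]) (auto simp: first_hit_def)
  next
    case False
    then show ?thesis using that k
      by (intro prod_zero bexI[of _ k]) (auto simp: first_hit_def)
  qed
  have "(\<Prod>j=1..m. first_hit D k j g (x j)) = (\<Prod>j=1..m. if j = k then g (x k) else 1)"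
    using k less_k by (intro prod.cong) (auto simp: first_hit_def)
  also have "\<dots> = g (x k)" using k by simp
  finally have "(\<Sum>i=1..m. \<Prod>j=1..m. first_hit D i j g (x j)) = g (x k)"
    using k zero by (subst sum.remove[of _ k]) (auto intro!: sum.neutral simp del: prod_zero_iff)
  also have "\<dots> \<le> Max ((\<lambda>i. g (x i)) ` {1..m})" using k by (intro Max_ge) auto
  finally show ?thesis .
qed

text \<open>Explains the weight in \<open>norm_star\<close>: with \<open>t\<close> the measure of
  the set, the \<open>i\<close>-th term is the probability of \<open>i - 1\<close> initial
  misses.\<close>

lemma sum_geometric_complement:
  fixes t :: real
  assumes "t \<noteq> 0"
  shows "(\<Sum>i=1..m. (1 - t) ^ (i - 1)) = (1 - (1 - t) ^ m) / t"
proof -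
  have "(\<Sum>i=1..m. (1 - t) ^ (i - 1)) = (\<Sum>i<m. (1 - t) ^ i)"
    by (rule sum.reindex_bij_witness[of _ Suc "\<lambda>i. i - 1"]) auto
  also have "\<dots> = (1 - (1 - t) ^ m) / t"
    using assms by (subst sum_gp_strict) auto
  finally show ?thesis .
qed

section \<open>Expectations over powers of a probability space\<close>

context prob_space
begin

lemma
  fixes h :: "'a \<Rightarrow> real"
  assumes "finite I" "i \<in> I" "integrable M h"
  shows integrable_PiM_coordinate: "integrable (\<Pi>\<^sub>M i\<in>I. M) (\<lambda>x. h (x i))"
    and integral_PiM_coordinate: "(LINT x|(\<Pi>\<^sub>M i\<in>I. M). h (x i)) = (LINT y|M. h y)"
proof -
  interpret P: product_sigma_finite "\<lambda>_. M" by unfold_locales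
  \<comment> \<open>Padding with the constant 1, whose integral is 1, turns a function of one
    coordinate into a product over all of them.\<close>
  define H where "H = (\<lambda>j. if j = i then h else (\<lambda>_. 1))"
  have int: "integrable M (H j)" for j using assms by (auto simp: H_def)
  have eq: "(\<Prod>j\<in>I. H j (x j)) = h (x i)" for x
  proof -
    have "(\<Prod>j\<in>I. H j (x j)) = (\<Prod>j\<in>I. if j = i then h (x i) else 1)"
      by (intro prod.cong) (auto simp: H_def)
    then show ?thesis using assms by simp
  qed
  have eq': "(\<Prod>j\<in>I. LINT y|M. H j y) = (LINT y|M. h y)"
  proof -
    have "(\<Prod>j\<in>I. LINT y|M. H j y) = (\<Prod>j\<in>I. if j = i then LINT y|M. h y else 1)"
      by (intro prod.cong) (auto simp: H_def prob_space)
    then show ?thesis using assms by simp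
  qed
  show "integrable (\<Pi>\<^sub>M i\<in>I. M) (\<lambda>x. h (x i))"
    using P.product_integrable_prod[OF assms(1), of H] int by (simp add: eq)
  show "(LINT x|(\<Pi>\<^sub>M i\<in>I. M). h (x i)) = (LINT y|M. h y)"
    using P.product_integral_prod[OF assms(1), of H] int by (simp add: eq eq')
qed

lemma integrable_PiM_Max:
  fixes g :: "'a \<Rightarrow> real"
  assumes "finite I" "I \<noteq> {}" "integrable M g" "\<And>y. g y \<ge> 0"
  shows "integrable (\<Pi>\<^sub>M i\<in>I. M) (\<lambda>x. Max ((\<lambda>i. g (x i)) ` I))"
proof (rule Bochner_Integration.integrable_bound)
  show "integrable (\<Pi>\<^sub>M i\<in>I. M) (\<lambda>x. \<Sum>i\<in>I. g (x i))"
    using assms by (intro Bochner_Integration.integrable_sum integrable_PiM_coordinate)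
  have "(\<lambda>x. g (x i)) \<in> borel_measurable (\<Pi>\<^sub>M i\<in>I. M)" if "i \<in> I" for i
    using integrable_PiM_coordinate[OF assms(1) that assms(3)] by simp
  then show "(\<lambda>x. Max ((\<lambda>i. g (x i)) ` I)) \<in> borel_measurable (\<Pi>\<^sub>M i\<in>I. M)"
    using assms by (intro borel_measurable_Max) auto
  have "norm (Max ((\<lambda>i. g (x i)) ` I)) \<le> norm (\<Sum>i\<in>I. g (x i))" for x
  proof -
    obtain k where "k \<in> I" using assms by auto
    then have "0 \<le> Max ((\<lambda>i. g (x i)) ` I)"
      using assms by (intro order.trans[OF assms(4)[of "x k"] Max_ge]) auto
    \<comment> \<open>At level 0 the excess of the nonnegative \<open>g\<close> is \<open>g\<close>
      itself.\<close>
    moreover have "Max ((\<lambda>i. g (x i)) ` I) \<le> (\<Sum>i\<in>I. g (x i))"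
      using Max_le_add_sum_excess[OF assms(1,2), of "\<lambda>i. g (x i)" 0] assms(4)
      by (simp add: max_absorb2)
    ultimately show ?thesis by simp
  qed
  then show "AE x in (\<Pi>\<^sub>M i\<in>I. M). norm (Max ((\<lambda>i. g (x i)) ` I)) \<le> norm (\<Sum>i\<in>I. g (x i))"
    by simp
qed

lemma integral_PiM_Max_le:
  fixes g :: "'a \<Rightarrow> real"
  assumes "finite I" "I \<noteq> {}" "integrable M g" "\<And>y. g y \<ge> 0"
  shows "(LINT x|(\<Pi>\<^sub>M i\<in>I. M). Max ((\<lambda>i. g (x i)) ` I))
    \<le> l + card I * (LINT y|M. max 0 (g y - l))"
proof -
  interpret P: prob_space "\<Pi>\<^sub>M i\<in>I. M"
    by (rule prob_space_PiM) unfold_locales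
  have int: "integrable M (\<lambda>y. max 0 (g y - l))"
    using assms by (intro Bochner_Integration.integrable_max) auto
  note coord = integrable_PiM_coordinate[OF assms(1) _ int]
  have "(LINT x|(\<Pi>\<^sub>M i\<in>I. M). Max ((\<lambda>i. g (x i)) ` I))
    \<le> (LINT x|(\<Pi>\<^sub>M i\<in>I. M). l + (\<Sum>i\<in>I. max 0 (g (x i) - l)))"
    using assms coord
    by (intro integral_mono integrable_PiM_Max Max_le_add_sum_excess
        Bochner_Integration.integrable_add Bochner_Integration.integrable_sum) auto
  also have "\<dots> = l + (\<Sum>i\<in>I. LINT x|(\<Pi>\<^sub>M i\<in>I. M). max 0 (g (x i) - l))"
    using coord by (subst Bochner_Integration.integral_add)
      (auto simp: P.prob_space Bochner_Integration.integral_sum)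
  also have "\<dots> = l + card I * (LINT y|M. max 0 (g y - l))"
    using integral_PiM_coordinate[OF assms(1) _ int] by simp
  finally show ?thesis .
qed

text \<open>Integrate the first-hit bound: independence factors each term, and the resulting
  geometric sum is the weight on the left.\<close>

lemma integral_PiM_Max_ge:
  fixes g :: "'a \<Rightarrow> real"
  assumes "m \<ge> 1" and g: "integrable M g" "\<And>y. g y \<ge> 0"
    and D: "D \<in> sets M" "prob D > 0"
  shows "(1 - (1 - prob D) ^ m) / prob D * (LINT y:D|M. g y)
    \<le> (LINT x|(\<Pi>\<^sub>M i\<in>{1..m}. M). Max ((\<lambda>i. g (x i)) ` {1..m}))"
proof -
  interpret P: product_sigma_finite "\<lambda>_. M" by unfold_locales
  have intD: "integrable M (\<lambda>y. indicator D y * g y)"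
    using integrable_mult_indicator[OF D(1) g(1)] by simp
  have ind: "integrable M (indicator D :: 'a \<Rightarrow> real)"
    using D by (simp add: emeasure_eq_measure)
  have int: "integrable M (first_hit D i j g)" for i j
    unfolding first_hit_def using intD ind by (cases "j < i"; cases "j = i") auto
  have prods: "(\<Prod>j=1..m. LINT y|M. first_hit D i j g y) = (1 - prob D) ^ (i - 1) * (LINT y:D|M. g y)"
    if "i \<in> {1..m}" for i
  proof -
    \<comment> \<open>Writing the three cases as a product of two conditionals lets the product over
      \<open>j\<close> separate into the misses before \<open>i\<close> and the hit at
      \<open>i\<close>.\<close>
    have "(LINT y|M. first_hit D i j g y) = (if j < i then 1 - prob D else 1) * (if j = i then (LINT y:D|M. g y) else 1)" for j
      using D ind
      by (auto simp: first_hit_def set_lebesgue_integral_def prob_space Bochner_Integration.integral_diff)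
    then have "(\<Prod>j=1..m. LINT y|M. first_hit D i j g y)
      = (\<Prod>j=1..m. if j < i then 1 - prob D else 1) * (\<Prod>j=1..m. if j = i then (LINT y:D|M. g y) else 1)"
      by (simp add: prod.distrib)
    moreover have "(\<Prod>j=1..m. if j = i then (LINT y:D|M. g y) else 1) = (LINT y:D|M. g y)"
      using that by simp
    moreover have "(\<Prod>j=1..m. if j < i then 1 - prob D else 1) = (1 - prob D) ^ (i - 1)"
    proof -
      have "(\<Prod>j=1..m. if j < i then 1 - prob D else 1) = (\<Prod>j\<in>{1..<i}. 1 - prob D)"
        using that by (intro prod.mono_neutral_cong_right) auto
      then show ?thesis by simp
    qed
    ultimately show ?thesis by simp
  qed
  have prod_int: "integrable (Pi\<^sub>M {1..m} (\<lambda>_. M)) (\<lambda>x. \<Prod>j=1..m. first_hit D i j g (x j))" for i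
    using int by (intro P.product_integrable_prod) auto
  have prod_eq: "(LINT x|Pi\<^sub>M {1..m} (\<lambda>_. M). (\<Prod>j=1..m. first_hit D i j g (x j)))
    = (\<Prod>j=1..m. LINT y|M. first_hit D i j g y)" for i
    using int by (intro P.product_integral_prod) auto
  have "(1 - (1 - prob D) ^ m) / prob D * (LINT y:D|M. g y)
    = (\<Sum>i=1..m. (1 - prob D) ^ (i - 1) * (LINT y:D|M. g y))"
    using sum_geometric_complement[of "prob D" m] D
    by (simp only: sum_distrib_right[symmetric])
  also have "\<dots> = (\<Sum>i=1..m. (LINT x|Pi\<^sub>M {1..m} (\<lambda>_. M). (\<Prod>j=1..m. first_hit D i j g (x j))))"
    using prods by (intro sum.cong) (simp_all only: prod_eq)
  also have "\<dots> = (LINT x|Pi\<^sub>M {1..m} (\<lambda>_. M). (\<Sum>i=1..m. \<Prod>j=1..m. first_hit D i j g (x j)))"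
    using prod_int by (intro Bochner_Integration.integral_sum[symmetric])
  also have "\<dots> \<le> (LINT x|(\<Pi>\<^sub>M i\<in>{1..m}. M). Max ((\<lambda>i. g (x i)) ` {1..m}))"
    using prod_int g \<open>m \<ge> 1\<close>
    by (intro integral_mono integrable_PiM_Max sum_first_hit_le_Max
        Bochner_Integration.integrable_sum) auto
  finally show ?thesis .
qed

section \<open>Quantiles of a nonnegative random variable\<close>

text \<open>Take the infimum of the levels whose strict upper tail has probability at most
  \<open>p\<close>; continuity of the measure from below and from above gives the two bounds. If
  \<open>g\<close> has an atom at \<open>l\<close>, both may be strict.\<close>

lemma exists_upper_quantile:
  fixes g :: "'a \<Rightarrow> real"
  assumes [measurable]: "g \<in> borel_measurable M" and "\<And>y. g y \<ge> 0" "0 < p" "p \<le> 1"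
  obtains l where "prob {y \<in> space M. g y > l} \<le> p" "p \<le> prob {y \<in> space M. g y \<ge> l}"
proof -
  \<comment> \<open>Admitting only levels \<open>s \<ge> 0\<close> bounds \<open>S\<close> below, at
    the price of a separate case \<open>l = 0\<close> later.\<close>
  define S where "S = {s. s \<ge> 0 \<and> prob {y \<in> space M. g y > s} \<le> p}"
  define l where "l = Inf S"
  \<comment> \<open>The tails decrease to the empty set, so some level has tail below
    \<open>p > 0\<close> and \<open>S\<close> is nonempty.\<close>
  have tail: "(\<lambda>n. prob {y \<in> space M. g y > real n}) \<longlonglongrightarrow> prob (\<Inter>n. {y \<in> space M. g y > real n})"
    by (rule finite_Lim_measure_decseq) (auto simp: decseq_def)
  have "(\<Inter>n. {y \<in> space M. g y > real n}) = {}"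
    using reals_Archimedean2 by (auto dest: less_asym)
  with tail have "(\<lambda>n. prob {y \<in> space M. g y > real n}) \<longlonglongrightarrow> 0" by simp
  from order_tendstoD(2)[OF this \<open>0 < p\<close>] obtain n where "prob {y \<in> space M. g y > real n} < p"
    by (auto simp: eventually_sequentially)
  then have "real n \<in> S" by (simp add: S_def)
  have bdd: "bdd_below S" by (auto simp: S_def bdd_below_def)
  have "l \<ge> 0" unfolding l_def
  proof (rule cInf_greatest)
    show "S \<noteq> {}" using \<open>real n \<in> S\<close> by blast
  qed (simp add: S_def)
  have above: "prob {y \<in> space M. g y > s} \<le> p" if "s > l" for s
  proof -
    obtain s' where "s' \<in> S" "s' < s"
      using cInf_lessD[of S s] \<open>s > l\<close> \<open>real n \<in> S\<close> unfolding l_def by auto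
    then have "prob {y \<in> space M. g y > s} \<le> prob {y \<in> space M. g y > s'}"
      by (intro finite_measure_mono) auto
    with \<open>s' \<in> S\<close> show ?thesis by (auto simp: S_def)
  qed
  have below: "p \<le> prob {y \<in> space M. g y > s}" if "s < l" "0 \<le> s" for s
    using that cInf_lower[OF _ bdd, of s] unfolding l_def[symmetric] by (force simp: S_def)
  have union: "(\<Union>n. {y \<in> space M. g y > l + 1 / real (Suc n)}) = {y \<in> space M. g y > l}"
  proof (intro equalityI subsetI)
    fix y assume "y \<in> {y \<in> space M. g y > l}"
    then obtain n where "inverse (real (Suc n)) < g y - l" "y \<in> space M"
      using reals_Archimedean[of "g y - l"] by auto
    then show "y \<in> (\<Union>n. {y \<in> space M. g y > l + 1 / real (Suc n)})"
      by (auto simp: inverse_eq_divide intro!: exI[of _ n])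
  next
    fix y assume "y \<in> (\<Union>n. {y \<in> space M. g y > l + 1 / real (Suc n)})"
    then obtain n where n: "y \<in> space M" "l + 1 / real (Suc n) < g y" by auto
    have "l < l + 1 / real (Suc n)" by simp
    also have "\<dots> < g y" by (rule n)
    finally show "y \<in> {y \<in> space M. g y > l}" using n by simp
  qed
  have "(\<lambda>n. prob {y \<in> space M. g y > l + 1 / real (Suc n)}) \<longlonglongrightarrow>
      prob (\<Union>n. {y \<in> space M. g y > l + 1 / real (Suc n)})"
  proof (rule finite_Lim_measure_incseq)
    have "1 / real (Suc k) \<le> 1 / real (Suc n)" if "n \<le> k" for n k
      using that by (intro divide_left_mono) auto
    then show "incseq (\<lambda>n. {y \<in> space M. g y > l + 1 / real (Suc n)})"
      by (force simp: incseq_def simp del: of_nat_Suc)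
  qed auto
  then have "prob {y \<in> space M. g y > l} \<le> p"
    unfolding union by (rule LIMSEQ_le_const2) (auto intro!: above)
  moreover have "p \<le> prob {y \<in> space M. g y \<ge> l}"
  proof (cases "l = 0")
    case True
    then have "{y \<in> space M. g y \<ge> l} = space M" using assms by auto
    then show ?thesis using assms prob_space by simp
  next
    case False
    with \<open>l \<ge> 0\<close> have "l > 0" by simp
    \<comment> \<open>The step \<open>l / real (Suc n)\<close> instead of
      \<open>1 / real (Suc n)\<close> keeps every level nonnegative, as \<open>below\<close>
      demands; \<open>n = 0\<close> gives level 0.\<close>
    have inter: "(\<Inter>n. {y \<in> space M. g y > l - l / real (Suc n)}) = {y \<in> space M. g y \<ge> l}"
    proof (intro equalityI subsetI)
      fix y assume y: "y \<in> (\<Inter>n. {y \<in> space M. g y > l - l / real (Suc n)})"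
      have "(\<lambda>n. l - l * inverse (real (Suc n))) \<longlonglongrightarrow> l - l * 0"
        by (intro tendsto_intros LIMSEQ_inverse_real_of_nat)
      then have "l - l * 0 \<le> g y"
        by (rule LIMSEQ_le_const2) (use y in \<open>auto simp: field_class.field_divide_inverse intro!: less_imp_le\<close>)
      then show "y \<in> {y \<in> space M. g y \<ge> l}" using y by auto
    next
      fix y assume "y \<in> {y \<in> space M. g y \<ge> l}"
      moreover have "l - l / real (Suc n) < l" for n using \<open>l > 0\<close> by simp
      ultimately show "y \<in> (\<Inter>n. {y \<in> space M. g y > l - l / real (Suc n)})"
        by (auto simp del: of_nat_Suc intro: less_le_trans[of _ l])
    qed
    have "(\<lambda>n. prob {y \<in> space M. g y > l - l / real (Suc n)}) \<longlonglongrightarrow>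
        prob (\<Inter>n. {y \<in> space M. g y > l - l / real (Suc n)})"
    proof (rule finite_Lim_measure_decseq)
      have "l / real (Suc k) \<le> l / real (Suc n)" if "n \<le> k" for n k
        using that \<open>l > 0\<close> by (intro divide_left_mono) auto
      then show "decseq (\<lambda>n. {y \<in> space M. g y > l - l / real (Suc n)})"
        by (force simp: decseq_def simp del: of_nat_Suc)
    qed auto
    moreover have "p \<le> prob {y \<in> space M. g y > l - l / real (Suc n)}" for n
      using \<open>l > 0\<close> by (intro below) (auto simp: field_simps)
    ultimately show ?thesis
      unfolding inter by (intro LIMSEQ_le_const[of _ _ p]) auto
  qed
  ultimately show ?thesis using that by blast
qed

end

section \<open>Sets of prescribed measure in the unit interval\<close>

lemma prob_space_unit_leb: "prob_space unit_leb"
  by (rule prob_spaceI) (simp add: emeasure_restrict_space)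

text \<open>Sweep \<open>B\<close> from left to right, adding to \<open>A\<close> what has been
  passed. The measure is 1-Lipschitz in the sweep position, so the intermediate value theorem
  applies.\<close>

lemma exists_between_measure_unit_leb:
  assumes A: "A \<in> sets unit_leb" and B: "B \<in> sets unit_leb" and "A \<subseteq> B"
    and p: "measure unit_leb A \<le> p" "p \<le> measure unit_leb B"
  obtains D where "D \<in> sets unit_leb" "A \<subseteq> D" "D \<subseteq> B" "measure unit_leb D = p"
proof -
  interpret prob_space unit_leb by (rule prob_space_unit_leb)
  define E where "E = (\<lambda>a. A \<union> (B \<inter> {0..a}))"
  have sub: "{x..y} \<in> sets unit_leb" if "0 \<le> x" "y \<le> 1" for x y :: real
    using that by (auto simp: sets_restrict_space_iff)
  have E: "E a \<in> sets unit_leb" if "a \<le> 1" for a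
    using A B sub[of 0 a] that by (auto simp: E_def)
  have mono: "measure unit_leb (E a) \<le> measure unit_leb (E b)" if "a \<le> b" "b \<le> 1" for a b
    using that by (intro finite_measure_mono E) (auto simp: E_def)
  have step: "measure unit_leb (E b) \<le> measure unit_leb (E a) + (b - a)"
    if "0 \<le> a" "a \<le> b" "b \<le> 1" for a b
  proof -
    have "measure unit_leb (E b) \<le> measure unit_leb (E a \<union> {a..b})"
      using that by (intro finite_measure_mono sets.Un E sub) (auto simp: E_def)
    also have "\<dots> \<le> measure unit_leb (E a) + measure unit_leb {a..b}"
      using that by (intro measure_Un_le E sub) auto
    also have "measure unit_leb {a..b} = b - a"
      using that by (subst measure_restrict_space) auto
    finally show ?thesis .
  qed
  have cont: "continuous_on {0..1} (\<lambda>a. measure unit_leb (E a))"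
  proof (rule continuous_onI)
    fix a e :: real assume "a \<in> {0..1}" "e > 0"
    moreover have "dist (measure unit_leb (E b)) (measure unit_leb (E a)) \<le> dist b a"
      if "b \<in> {0..1}" for b
      using that \<open>a \<in> {0..1}\<close> mono[of a b] mono[of b a] step[of a b] step[of b a]
      by (cases "a \<le> b") (auto simp: dist_real_def)
    ultimately show "\<exists>d>0. \<forall>b\<in>{0..1}. dist b a < d \<longrightarrow>
        dist (measure unit_leb (E b)) (measure unit_leb (E a)) \<le> e"
      by (intro exI[of _ e]) force
  qed
  have "B \<subseteq> {0..1}" using sets.sets_into_space[OF B] by simp
  then have "E 1 = B" using \<open>A \<subseteq> B\<close> by (auto simp: E_def)
  \<comment> \<open>\<open>E 0\<close> can exceed \<open>A\<close> only by the null set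
    \<open>{0}\<close>.\<close>
  have "measure unit_leb (E 0) \<le> p"
  proof -
    have "measure unit_leb (E 0) \<le> measure unit_leb (A \<union> {0..0})"
      using A sub[of 0 0] by (intro finite_measure_mono sets.Un) (auto simp: E_def)
    also have "\<dots> \<le> measure unit_leb A + measure unit_leb {0..0}"
      using A sub[of 0 0] by (intro measure_Un_le) auto
    also have "measure unit_leb {0..0::real} = 0"
      by (subst measure_restrict_space) auto
    finally show ?thesis using p by simp
  qed
  then obtain a where "0 \<le> a" "a \<le> 1" "measure unit_leb (E a) = p"
    using IVT'[of "\<lambda>a. measure unit_leb (E a)" 0 p 1] cont p \<open>E 1 = B\<close> by auto
  with E \<open>A \<subseteq> B\<close> show ?thesis by (intro that[of "E a"]) (auto simp: E_def)
qed

text \<open>Take \<open>l\<close> as a quantile for \<open>1 / real m\<close> and \<open>D\<close>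
  between the strict and the weak upper level set of \<open>g\<close>; the bound by expected
  excesses then loses its dependence on \<open>l\<close>.\<close>

lemma exists_set_integral_ge_norm_m_inf:
  assumes "m \<ge> 1" and f: "integrable unit_leb f"
  obtains D where "D \<in> sets unit_leb" "measure unit_leb D = 1 / real m"
    "norm_m_inf m f \<le> real m * (LINT x:D|unit_leb. \<bar>f x\<bar>)"
proof -
  interpret prob_space unit_leb by (rule prob_space_unit_leb)
  define g where "g = (\<lambda>x. \<bar>f x\<bar>)"
  have g: "integrable unit_leb g" "\<And>x. g x \<ge> 0" using f by (auto simp: g_def)
  have [measurable]: "g \<in> borel_measurable unit_leb" using g by simp
  obtain l where l: "prob {y \<in> space unit_leb. g y > l} \<le> 1 / real m"
    "1 / real m \<le> prob {y \<in> space unit_leb. g y \<ge> l}"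
    using exists_upper_quantile[of g "1 / real m"] g \<open>m \<ge> 1\<close> by auto
  obtain D where D: "D \<in> sets unit_leb" "{y \<in> space unit_leb. g y > l} \<subseteq> D"
    "D \<subseteq> {y \<in> space unit_leb. g y \<ge> l}" "prob D = 1 / real m"
  proof (rule exists_between_measure_unit_leb[OF _ _ _ l])
    show "{y \<in> space unit_leb. g y > l} \<in> sets unit_leb" by measurable
    show "{y \<in> space unit_leb. g y \<ge> l} \<in> sets unit_leb" by measurable
    show "{y \<in> space unit_leb. g y > l} \<subseteq> {y \<in> space unit_leb. g y \<ge> l}" by auto
  qed
  have intD: "integrable unit_leb (\<lambda>y. indicator D y * g y)"
    using integrable_mult_indicator[OF D(1) g(1)] by simp
  have ind: "integrable unit_leb (indicator D :: real \<Rightarrow> real)"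
    using D by (simp add: emeasure_eq_measure)
  \<comment> \<open>Since \<open>g\<close> is at least \<open>l\<close> on \<open>D\<close> and at
    most \<open>l\<close> off \<open>D\<close>, the integrands agree pointwise on the space.\<close>
  have "(LINT y|unit_leb. max 0 (g y - l)) = (LINT y|unit_leb. indicator D y * g y - l * indicator D y)"
    using D by (intro Bochner_Integration.integral_cong) (force split: split_indicator)+
  also have "\<dots> = (LINT y:D|unit_leb. g y) - l / real m"
    using intD ind D(4) sets.Int_space_eq2[OF D(1)] by (simp add: set_lebesgue_integral_def del: space_restrict_space)
  finally have excess: "(LINT y|unit_leb. max 0 (g y - l)) = (LINT y:D|unit_leb. g y) - l / real m" .
  have "norm_m_inf m f \<le> l + real m * (LINT y|unit_leb. max 0 (g y - l))"
    using integral_PiM_Max_le[of "{1..m}" g l] g \<open>m \<ge> 1\<close>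
    unfolding norm_m_inf_def g_def by simp
  \<comment> \<open>The measure \<open>1 / real m\<close> of \<open>D\<close> makes the two
    contributions of \<open>l\<close> cancel.\<close>
  also have "\<dots> = real m * (LINT y:D|unit_leb. g y)"
    unfolding excess using \<open>m \<ge> 1\<close> by (simp add: field_simps)
  finally show ?thesis using D that unfolding g_def by blast
qed

theorem theorem2:
  fixes m :: nat and f :: "real \<Rightarrow> real"
  assumes "m \<ge> 1"
    and "integrable unit_leb f"
  shows "(1 - 1 / exp 1) * norm_prime m f \<le> norm_star m f
    \<and> norm_star m f \<le> norm_m_inf m f
    \<and> norm_m_inf m f \<le> 2 * norm_prime m f"
proof -
  interpret prob_space unit_leb by (rule prob_space_unit_leb)
  define c :: real where "c = 1 - 1 / exp 1"
  have "c > 0" by (simp add: c_def)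
  have nonneg: "0 \<le> (LINT x:D|unit_leb. \<bar>f x\<bar>)" for D
    unfolding set_lebesgue_integral_def by (intro integral_nonneg_AE) simp
  \<comment> \<open>Used twice: to bound the supremum \<open>norm_star\<close>, and to show that its
    family is bounded above, so that single members lie below it.\<close>
  have star_le: "(1 - (1 - prob D) ^ m) / prob D * (LINT x:D|unit_leb. \<bar>f x\<bar>) \<le> norm_m_inf m f"
    if "D \<in> {D \<in> sets unit_leb. prob D > 0}" for D
    using integral_PiM_Max_ge[of m "\<lambda>x. \<bar>f x\<bar>" D] that assms by (simp add: norm_m_inf_def)
  have "{0..1} \<in> {D \<in> sets unit_leb. prob D > 0}"
    using prob_space sets.top[of unit_leb] by simp
  then have star: "norm_star m f \<le> norm_m_inf m f"
    unfolding norm_star_def using star_le by (intro cSUP_least) auto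
  obtain D0 where D0: "D0 \<in> sets unit_leb" "prob D0 = 1 / real m"
    "norm_m_inf m f \<le> real m * (LINT x:D0|unit_leb. \<bar>f x\<bar>)"
    using exists_set_integral_ge_norm_m_inf[OF assms] .
  \<comment> \<open>Dividing by \<open>c\<close> gives a bound free of \<open>D\<close>, which
    serves both as an upper bound for \<open>norm_prime\<close> and as boundedness of its
    family.\<close>
  have prime_le: "real m * (LINT x:D|unit_leb. \<bar>f x\<bar>) \<le> norm_star m f / c"
    if D: "D \<in> {D \<in> sets unit_leb. prob D = 1 / real m}" for D
  proof -
    \<comment> \<open>This is \<open>1 + x \<le> exp x\<close> at \<open>x = - 1 / real m\<close>;
      the base is nonnegative because \<open>m \<ge> 1\<close>.\<close>
    have "(1 - 1 / real m) ^ m \<le> exp (- 1 / real m) ^ m"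
      using exp_ge_add_one_self[of "- 1 / real m"] \<open>m \<ge> 1\<close> by (intro power_mono) auto
    also have "\<dots> = 1 / exp 1"
      using \<open>m \<ge> 1\<close> by (simp add: exp_of_nat_mult[symmetric] exp_minus field_simps)
    finally have "c \<le> 1 - (1 - 1 / real m) ^ m" by (simp add: c_def)
    then have "c * (real m * (LINT x:D|unit_leb. \<bar>f x\<bar>))
      \<le> (1 - (1 - prob D) ^ m) / prob D * (LINT x:D|unit_leb. \<bar>f x\<bar>)"
      using D nonneg[of D] \<open>m \<ge> 1\<close>
      by (simp add: mult.assoc mult_right_mono)
    also have "\<dots> \<le> norm_star m f"
      unfolding norm_star_def
      using D \<open>m \<ge> 1\<close> star_le by (intro cSUP_upper bdd_aboveI2[of _ _ "norm_m_inf m f"]) auto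
    finally show ?thesis using \<open>c > 0\<close> by (simp add: field_simps)
  qed
  \<comment> \<open>\<open>D0\<close> also witnesses that the supremum runs over a nonempty
    family.\<close>
  have "norm_prime m f \<le> norm_star m f / c"
    unfolding norm_prime_def using D0 prime_le by (intro cSUP_least) auto
  then have first: "c * norm_prime m f \<le> norm_star m f"
    using \<open>c > 0\<close> by (simp add: field_simps)
  have D0_le: "real m * (LINT x:D0|unit_leb. \<bar>f x\<bar>) \<le> norm_prime m f"
    unfolding norm_prime_def
    using D0 prime_le by (intro cSUP_upper bdd_aboveI2[of _ _ "norm_star m f / c"]) auto
  \<comment> \<open>Nonnegativity of \<open>norm_prime\<close> follows, which relaxes the constant 1
    to 2.\<close>
  moreover have "0 \<le> real m * (LINT x:D0|unit_leb. \<bar>f x\<bar>)" using nonneg by simp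
  ultimately have "norm_m_inf m f \<le> 2 * norm_prime m f" using D0 by linarith
  with first star show ?thesis unfolding c_def by blast
qed

end
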